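(* Every quaternion $q = w + x\boldsymbol{i} + y\boldsymbol{j} + z\boldsymbol{k}$, where $w, x, y, z\in\mathbb{R}$, can be expressed in the form $q = A e^{B\boldsymbol{j}}$, where $A = a + b\boldsymbol{i}$ and $B = c + d\boldsymbol{i}$ for some real numbers $a, b, c, d$ (depending on $q$).
   Context: Quaternions are the real algebra with basis $1, \boldsymbol{i}, \boldsymbol{j}, \boldsymbol{k}$ and multiplication determined by $\boldsymbol{i}^2 = \boldsymbol{j}^2 = \boldsymbol{k}^2 = \boldsymbol{i}\boldsymbol{j}\boldsymbol{k} = -1$. A complex number $a + b\boldsymbol{i}$ ($a,b$ real) is treated as the degenerate quaternion $a + b\boldsymbol{i} + 0\boldsymbol{j} + 0\boldsymbol{k}$, and all products are quaternion products; in particular $B\boldsymbol{j} = (c + d\boldsymbol{i})\boldsymbol{j} = c\boldsymbol{j} + d\boldsymbol{k}$, and $A e^{B\boldsymbol{j}}$ is the quaternion product of $A$ (on the left) with $e^{B\boldsymbol{j}}$. The exponential $e^{p}$ of a quaternion $p$ is the usual quaternion exponential $\sum_{n\ge 0} p^n/n!$. *)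

theory Defs
  imports "HOL-Analysis.Analysis"
begin

datatype quat = Quat (qRe: real) (qIm1: real) (qIm2: real) (qIm3: real)

lemma quat_eq_iff:
  "p = q \<longleftrightarrow> qRe p = qRe q \<and> qIm1 p = qIm1 q \<and> qIm2 p = qIm2 q \<and> qIm3 p = qIm3 q"
  by (cases p; cases q) simp

instantiation quat :: ab_group_add
begin

definition zero_quat :: quat where
  "0 = Quat 0 0 0 0"

definition plus_quat :: "quat \<Rightarrow> quat \<Rightarrow> quat" where
  "p + q = Quat (qRe p + qRe q) (qIm1 p + qIm1 q) (qIm2 p + qIm2 q) (qIm3 p + qIm3 q)"

definition uminus_quat :: "quat \<Rightarrow> quat" where
  "- p = Quat (- qRe p) (- qIm1 p) (- qIm2 p) (- qIm3 p)"

definition minus_quat :: "quat \<Rightarrow> quat \<Rightarrow> quat" where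
  "p - q = Quat (qRe p - qRe q) (qIm1 p - qIm1 q) (qIm2 p - qIm2 q) (qIm3 p - qIm3 q)"

instance
  by standard
    (simp_all add: zero_quat_def plus_quat_def uminus_quat_def minus_quat_def quat_eq_iff)

end

lemma quat_add_simps [simp]:
  "qRe 0 = 0" "qIm1 0 = 0" "qIm2 0 = 0" "qIm3 0 = 0"
  "qRe (p + q) = qRe p + qRe q" "qIm1 (p + q) = qIm1 p + qIm1 q"
  "qIm2 (p + q) = qIm2 p + qIm2 q" "qIm3 (p + q) = qIm3 p + qIm3 q"
  "qRe (- p) = - qRe p" "qIm1 (- p) = - qIm1 p"
  "qIm2 (- p) = - qIm2 p" "qIm3 (- p) = - qIm3 p"
  "qRe (p - q) = qRe p - qRe q" "qIm1 (p - q) = qIm1 p - qIm1 q"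
  "qIm2 (p - q) = qIm2 p - qIm2 q" "qIm3 (p - q) = qIm3 p - qIm3 q"
  by (simp_all add: zero_quat_def plus_quat_def uminus_quat_def minus_quat_def)

text \<open>The product is the bilinear extension of \<open>i\<^sup>2 = j\<^sup>2 = k\<^sup>2 = ijk = -1\<close>;
  these relations are proved below as \<open>quat_relations\<close>.\<close>

instantiation quat :: real_algebra_1
begin

definition one_quat :: quat where
  "1 = Quat 1 0 0 0"

definition times_quat :: "quat \<Rightarrow> quat \<Rightarrow> quat" where
  "p * q = Quat
     (qRe p * qRe q - qIm1 p * qIm1 q - qIm2 p * qIm2 q - qIm3 p * qIm3 q)
     (qRe p * qIm1 q + qIm1 p * qRe q + qIm2 p * qIm3 q - qIm3 p * qIm2 q)
     (qRe p * qIm2 q - qIm1 p * qIm3 q + qIm2 p * qRe q + qIm3 p * qIm1 q)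
     (qRe p * qIm3 q + qIm1 p * qIm2 q - qIm2 p * qIm1 q + qIm3 p * qRe q)"

definition scaleR_quat :: "real \<Rightarrow> quat \<Rightarrow> quat" where
  "r *\<^sub>R q = Quat (r * qRe q) (r * qIm1 q) (r * qIm2 q) (r * qIm3 q)"

instance
  by standard
    (unfold quat_eq_iff, simp_all add: one_quat_def times_quat_def scaleR_quat_def algebra_simps)

end

lemma quat_mult_simps [simp]:
  "qRe 1 = 1" "qIm1 1 = 0" "qIm2 1 = 0" "qIm3 1 = 0"
  "qRe (p * q) = qRe p * qRe q - qIm1 p * qIm1 q - qIm2 p * qIm2 q - qIm3 p * qIm3 q"
  "qIm1 (p * q) = qRe p * qIm1 q + qIm1 p * qRe q + qIm2 p * qIm3 q - qIm3 p * qIm2 q"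
  "qIm2 (p * q) = qRe p * qIm2 q - qIm1 p * qIm3 q + qIm2 p * qRe q + qIm3 p * qIm1 q"
  "qIm3 (p * q) = qRe p * qIm3 q + qIm1 p * qIm2 q - qIm2 p * qIm1 q + qIm3 p * qRe q"
  "qRe (r *\<^sub>R p) = r * qRe p" "qIm1 (r *\<^sub>R p) = r * qIm1 p"
  "qIm2 (r *\<^sub>R p) = r * qIm2 p" "qIm3 (r *\<^sub>R p) = r * qIm3 p"
  by (simp_all add: one_quat_def times_quat_def scaleR_quat_def)

lemma quat_of_real_simps [simp]:
  "qRe (of_real r) = r" "qIm1 (of_real r) = 0" "qIm2 (of_real r) = 0" "qIm3 (of_real r) = 0"
  by (simp_all add: of_real_def)

definition quat_i :: quat where "quat_i = Quat 0 1 0 0"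
definition quat_j :: quat where "quat_j = Quat 0 0 1 0"
definition quat_k :: quat where "quat_k = Quat 0 0 0 1"

lemma quat_basis_simps [simp]:
  "qRe quat_i = 0" "qIm1 quat_i = 1" "qIm2 quat_i = 0" "qIm3 quat_i = 0"
  "qRe quat_j = 0" "qIm1 quat_j = 0" "qIm2 quat_j = 1" "qIm3 quat_j = 0"
  "qRe quat_k = 0" "qIm1 quat_k = 0" "qIm2 quat_k = 0" "qIm3 quat_k = 1"
  by (simp_all add: quat_i_def quat_j_def quat_k_def)

lemma quat_relations:
  "quat_i ^ 2 = - 1" "quat_j ^ 2 = - 1" "quat_k ^ 2 = - 1" "quat_i * quat_j * quat_k = - 1"
  "quat_i * quat_j = quat_k"
  by (simp_all add: power2_eq_square quat_eq_iff)

lemma quat_expand: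
  "Quat w x y z = of_real w + of_real x * quat_i + of_real y * quat_j + of_real z * quat_k"
  by (simp add: quat_eq_iff)

text \<open>The Euclidean norm makes the quaternions a Banach algebra, so that the library's power
  series \<open>exp\<close> applies to them.\<close>

instantiation quat :: real_inner
begin

definition inner_quat :: "quat \<Rightarrow> quat \<Rightarrow> real" where
  "inner p q = qRe p * qRe q + qIm1 p * qIm1 q + qIm2 p * qIm2 q + qIm3 p * qIm3 q"

definition norm_quat :: "quat \<Rightarrow> real" where
  "norm (q :: quat) = sqrt (inner q q)"

definition sgn_quat :: "quat \<Rightarrow> quat" where
  "sgn (q :: quat) = q /\<^sub>R norm q"

definition dist_quat :: "quat \<Rightarrow> quat \<Rightarrow> real" where
  "dist (p :: quat) q = norm (p - q)"

definition uniformity_quat :: "(quat \<times> quat) filter" where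
  "uniformity = (INF e\<in>{0<..}. principal {(p, q). dist (p :: quat) q < e})"

definition open_quat :: "quat set \<Rightarrow> bool" where
  "open (U :: quat set) \<longleftrightarrow> (\<forall>p\<in>U. eventually (\<lambda>(p', q). p' = p \<longrightarrow> q \<in> U) uniformity)"

instance
proof
  fix p q s :: quat and r :: real and U :: "quat set"
  show "inner p p = 0 \<longleftrightarrow> p = 0"
    by (simp add: inner_quat_def quat_eq_iff add_nonneg_eq_0_iff)
  show "inner p q = inner q p"
    by (simp add: inner_quat_def mult.commute)
  show "inner (p + q) s = inner p s + inner q s"
    by (simp add: inner_quat_def distrib_right)
  show "inner (r *\<^sub>R p) q = r * inner p q"
    by (simp add: inner_quat_def distrib_left)
  show "0 \<le> inner p p"
    by (simp add: inner_quat_def)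
  show "norm p = sqrt (inner p p)"
    by (simp add: norm_quat_def inner_quat_def power2_eq_square)
  show "sgn p = p /\<^sub>R norm p"
    by (rule sgn_quat_def)
  show "dist p q = norm (p - q)"
    by (rule dist_quat_def)
  show "(uniformity :: (quat \<times> quat) filter) = (INF e\<in>{0<..}. principal {(p, q). dist p q < e})"
    by (rule uniformity_quat_def)
  show "open U \<longleftrightarrow> (\<forall>p\<in>U. \<forall>\<^sub>F (p', q) in uniformity. p' = p \<longrightarrow> q \<in> U)"
    by (rule open_quat_def)
qed

end

instantiation quat :: euclidean_space
begin

definition Basis_quat :: "quat set" where
  "Basis = {1, quat_i, quat_j, quat_k}"

instance
proof
  show "(Basis :: quat set) \<noteq> {}" and "finite (Basis :: quat set)"
    by (simp_all add: Basis_quat_def)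
next
  fix u v :: quat
  assume "u \<in> Basis" and "v \<in> Basis"
  then have "u = 1 \<or> u = quat_i \<or> u = quat_j \<or> u = quat_k"
    and "v = 1 \<or> v = quat_i \<or> v = quat_j \<or> v = quat_k"
    by (simp_all add: Basis_quat_def)
  then show "inner u v = (if u = v then 1 else 0)"
    by (elim disjE; simp only: inner_quat_def quat_eq_iff; simp)
next
  fix p :: quat
  have "(\<forall>u\<in>Basis. inner p u = 0) \<longleftrightarrow>
      qRe p = 0 \<and> qIm1 p = 0 \<and> qIm2 p = 0 \<and> qIm3 p = 0"
    by (simp add: Basis_quat_def inner_quat_def)
  then show "(\<forall>u\<in>Basis. inner p u = 0) \<longleftrightarrow> p = 0"
    by (simp only: quat_eq_iff quat_add_simps)
qed

end

instance quat :: real_normed_algebra_1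
proof
  fix p q :: quat
  have "inner (p * q) (p * q) = inner p p * inner q q"
    by (simp add: inner_quat_def algebra_simps)
  then show "norm (p * q) \<le> norm p * norm q"
    by (simp add: norm_eq_sqrt_inner real_sqrt_mult)
  show "norm (1 :: quat) = 1"
    by (simp add: norm_quat_def inner_quat_def)
qed

lemma exp_quat_series: "exp (q :: quat) = (\<Sum>n. q ^ n /\<^sub>R fact n)"
  by (simp add: exp_def)

end

(* Read q as \<alpha> + \<beta> j with \<alpha> = w + x i and \<beta> = y + z i.  For B = t e^(is) with t, s real, u = e^(is) j
   squares to -1, so e^(Bj) = cos t + (sin t) e^(is) j, and the claim becomes the pair of complex
   equations \<alpha> = A cos t, \<beta> = A (sin t) e^(is).  If \<alpha> is nonzero, the polar form of \<beta> / \<alpha> gives s and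
   tan t, and then A = \<alpha> / cos t; if \<alpha> = 0, take t = pi / 2, s = 0 and A = \<beta>. *)

theory Submission
  imports Defs
begin

text \<open>\<open>x + y i \<mapsto> x + y u\<close> is a bounded algebra homomorphism, so it carries the exponential series
  of \<open>i t\<close> to that of \<open>t u\<close>.\<close>

lemma exp_scaleR_imaginary_unit:
  fixes u :: "'a::{real_normed_algebra_1,banach}"
  assumes "u * u = - 1"
  shows "exp (t *\<^sub>R u) = of_real (cos t) + sin t *\<^sub>R u"
proof -
  define h :: "complex \<Rightarrow> 'a" where "h z = of_real (Re z) + Im z *\<^sub>R u" for z
  have "linear h"
    by (rule linearI) (simp_all add: h_def algebra_simps scaleR_conv_of_real)
  \<comment> \<open>Linear maps out of the finite-dimensional space \<open>complex\<close> are
    bounded.\<close>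
  then have bl: "bounded_linear h"
    by (simp add: linear_conv_bounded_linear)
  have mult: "h (v * z) = h v * h z" for v z
    using assms by (simp add: h_def algebra_simps of_real_def)
  have "h 1 = 1"
    by (simp add: h_def)
  then have power: "h (z ^ n) = h z ^ n" for z n
    by (induction n) (simp_all add: mult)
  have "(\<lambda>n. h (z ^ n /\<^sub>R fact n)) sums h (exp z)" for z
    by (rule bounded_linear.sums[OF bl exp_converges])
  then have "(\<lambda>n. h z ^ n /\<^sub>R fact n) sums h (exp z)" for z
    by (simp only: linear_cmul[OF \<open>linear h\<close>] power)
  then have "exp (h z) = h (exp z)" for z
    using exp_converges sums_unique2 by blast
  from this[of "\<i> * of_real t"] show ?thesis
    by (simp add: h_def flip: cis_conv_exp)
qed

lemma complex_pair_polar: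
  obtains A :: complex and t s :: real
  where "\<alpha> = A * of_real (cos t)" "\<beta> = A * of_real (sin t) * cis s"
proof (cases "\<alpha> = 0")
  case True
  then show ?thesis
    using that[of \<beta> "pi / 2" 0] by simp
next
  case False
  define r where "r = cmod (\<beta> / \<alpha>)"
  define t where "t = arctan r"
  \<comment> \<open>\<open>arctan\<close> takes its values strictly between -pi/2 and pi/2.\<close>
  have "cos t \<noteq> 0"
    by (simp add: t_def)
  moreover have "sin t = r * cos t"
    using \<open>cos t \<noteq> 0\<close> tan_arctan[of r] by (simp add: t_def tan_def field_simps)
  moreover have "\<alpha> * of_real r * cis (Arg (\<beta> / \<alpha>)) = \<beta>"
    using False rcis_cmod_Arg[of "\<beta> / \<alpha>"] by (simp add: r_def rcis_def mult.assoc)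
  ultimately show ?thesis
    using that[of "\<alpha> / of_real (cos t)" t "Arg (\<beta> / \<alpha>)"] by simp
qed

theorem theorem1:
  fixes q :: quat
  shows "\<exists>a b c d :: real.
    q = (of_real a + of_real b * quat_i) * exp ((of_real c + of_real d * quat_i) * quat_j)"
proof -
  obtain A t s
    where re: "Complex (qRe q) (qIm1 q) = A * of_real (cos t)"
      and im: "Complex (qIm2 q) (qIm3 q) = A * of_real (sin t) * cis s"
    by (rule complex_pair_polar)
  \<comment> \<open>This is e^(is) j, since i j = k; hence B j = t u for B = t e^(is).\<close>
  define u where "u = Quat 0 0 (cos s) (sin s)"
  have "u * u = - 1"
    by (simp add: u_def quat_eq_iff) (use sin_cos_squared_add3[of s] in linarith)
  moreover have "(of_real (t * cos s) + of_real (t * sin s) * quat_i) * quat_j = t *\<^sub>R u"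
    by (simp add: u_def quat_eq_iff)
  ultimately have "exp ((of_real (t * cos s) + of_real (t * sin s) * quat_i) * quat_j)
      = of_real (cos t) + sin t *\<^sub>R u"
    by (simp only: exp_scaleR_imaginary_unit)
  \<comment> \<open>The product on the right is A cos t + (A (sin t) e^(is)) j; \<open>re\<close>
    and \<open>im\<close> match its two complex components with those of \<open>q\<close>.\<close>
  then have "q = (of_real (Re A) + of_real (Im A) * quat_i)
      * exp ((of_real (t * cos s) + of_real (t * sin s) * quat_i) * quat_j)"
    using re im by (simp add: u_def quat_eq_iff complex_eq_iff algebra_simps)
  then show ?thesis
    by blast
qed

end
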